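(* Let $\varrho$ be a normalized proximate order of order $\rho>0$, let $\sigma\ge0$, and let $f(x)=\sum_{\ell=0}^\infty x^\ell a_\ell\in\mathcal{SM}_L(\mathbb{R}^{n+1})$ ($a_\ell\in\mathbb{R}_n$). Then the following are equivalent: (1) $f\in A_{\varrho,\sigma+0}$; (2) $\limsup_{r\to\infty}\frac{\sup_{|x|\le r}\ln|f(x)|}{r^{\varrho(r)}}\le\sigma$; (3) $\limsup_{\ell\to\infty}|a_\ell|^{1/\ell}\varphi(\ell)\le(e\rho\sigma)^{1/\rho}$; (4) $\inf\{\beta>0: f\in A_{\varrho,\beta}\}\le\sigma$.
   Context: $\mathbb{R}_n$ is the real Clifford algebra generated by $e_1,\dots,e_n$ with $e_ie_j=-e_je_i$ ($i\ne j$), $e_i^2=-1$, with Euclidean norm $|a|^2=\sum_Aa_A^2$ for $a=\sum_Aa_Ae_A$. Paravectors $x=x_0+\sum x_\ell e_\ell$ are identified with $\mathbb{R}^{n+1}$; $\mathbb{S}=\{\sum x_\ell e_\ell:\sum x_\ell^2=1\}$. $\mathcal{SM}_L(\mathbb{R}^{n+1})$ is the set of entire left slice monogenic functions: $f(u+jv)=f_0(u,v)+jf_1(u,v)$ for all $u,v\in\mathbb{R}$, $j\in\mathbb{S}$, with $f_0,f_1:\mathbb{R}^2\to\mathbb{R}_n$ continuously differentiable, $f_0$ even and $f_1$ odd in $v$, and $\partial_uf_0=\partial_vf_1$, $\partial_vf_0=-\partial_uf_1$. Every such $f$ equals its everywhere convergent series $\sum x^\ell a_\ell$ with $a_\ell=\partial_{x_0}^\ell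 f(0)/\ell!$. A proximate order is a differentiable $\varrho:[0,\infty)\to[0,\infty)$ with $\lim_{r\to\infty}\varrho(r)=\rho>0$ and $\lim_{r\to\infty}\varrho'(r)r\ln r=0$; normalized means $r\mapsto r^{\varrho(r)}$ is strictly increasing on $(0,\infty)$ and tends to $0$ as $r\to0^+$; $\varphi:(0,\infty)\to(0,\infty)$ is the inverse of $r\mapsto r^{\varrho(r)}$. For $\sigma>0$: $A_{\varrho,\sigma}=\{f\in\mathcal{SM}_L(\mathbb{R}^{n+1}):\sup_x|f(x)|e^{-\sigma|x|^{\varrho(|x|)}}<\infty\}$; for $\sigma\ge0$: $A_{\varrho,\sigma+0}=\bigcap_{\epsilon>0}A_{\varrho,\sigma+\epsilon}$. *)

theory Defs
  imports "HOL-Analysis.Analysis" "HOL-Library.Extended_Real"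
begin

text \<open>Real Clifford algebra R_n: an element is a real-valued function on index sets
  A (standing for the basis blade e_A), vanishing outside the subsets of {1..n}.\<close>

type_synonym cliff = "nat set \<Rightarrow> real"

definition clifford :: "nat \<Rightarrow> cliff set" where
  "clifford n = {a. \<forall>A. \<not> A \<subseteq> {1..n} \<longrightarrow> a A = 0}"

text \<open>Sign of e_A e_B = sign * e_(A sym-diff B), for e_i e_j = - e_j e_i, e_i^2 = -1.\<close>
definition cl_sign :: "nat set \<Rightarrow> nat set \<Rightarrow> real" where
  "cl_sign A B = (-1) ^ (card {(a, b). a \<in> A \<and> b \<in> B \<and> b < a} + card (A \<inter> B))"

definition cl_mult :: "nat \<Rightarrow> cliff \<Rightarrow> cliff \<Rightarrow> cliff" where
  "cl_mult n a b = (\<lambda>C. \<Sum>A\<in>Pow {1..n}. \<Sum>B\<in>Pow {1..n}.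
      (if (A - B) \<union> (B - A) = C then cl_sign A B * a A * b B else 0))"

definition cl_norm :: "nat \<Rightarrow> cliff \<Rightarrow> real" where
  "cl_norm n a = sqrt (\<Sum>A\<in>Pow {1..n}. (a A)\<^sup>2)"

definition cl_real :: "real \<Rightarrow> cliff" where
  "cl_real t = (\<lambda>A. if A = {} then t else 0)"

fun cl_pow :: "nat \<Rightarrow> cliff \<Rightarrow> nat \<Rightarrow> cliff" where
  "cl_pow n x 0 = cl_real 1"
| "cl_pow n x (Suc k) = cl_mult n x (cl_pow n x k)"

text \<open>Paravectors x_0 + sum x_l e_l, identified with R^(n+1).\<close>
definition paravec :: "nat \<Rightarrow> cliff set" where
  "paravec n = {x \<in> clifford n. \<forall>A. 2 \<le> card A \<longrightarrow> x A = 0}"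

definition unit_sphere :: "nat \<Rightarrow> cliff set" where
  "unit_sphere n = {j \<in> paravec n. j {} = 0 \<and> (\<Sum>l\<in>{1..n}. (j {l})\<^sup>2) = 1}"

definition para :: "real \<Rightarrow> real \<Rightarrow> cliff \<Rightarrow> cliff" where
  "para u v j = (\<lambda>A. cl_real u A + v * j A)"

definition SM_L :: "nat \<Rightarrow> (cliff \<Rightarrow> cliff) \<Rightarrow> bool" where
  "SM_L n f \<longleftrightarrow> (\<exists>(f0::real\<Rightarrow>real\<Rightarrow>cliff) (f1::real\<Rightarrow>real\<Rightarrow>cliff) D0u D0v D1u D1v.
      (\<forall>u v. f0 u v \<in> clifford n \<and> f1 u v \<in> clifford n) \<and>
      (\<forall>u v j. j \<in> unit_sphere n \<longrightarrow>
          f (para u v j) = (\<lambda>A. f0 u v A + cl_mult n j (f1 u v) A)) \<and>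
      (\<forall>u v. f0 u (-v) = f0 u v \<and> f1 u (-v) = (\<lambda>A. - f1 u v A)) \<and>
      (\<forall>A. (\<forall>u v.
            ((\<lambda>t. f0 t v A) has_real_derivative D0u u v A) (at u) \<and>
            ((\<lambda>t. f0 u t A) has_real_derivative D0v u v A) (at v) \<and>
            ((\<lambda>t. f1 t v A) has_real_derivative D1u u v A) (at u) \<and>
            ((\<lambda>t. f1 u t A) has_real_derivative D1v u v A) (at v)) \<and>
          continuous_on UNIV (\<lambda>p::real\<times>real. D0u (fst p) (snd p) A) \<and>
          continuous_on UNIV (\<lambda>p::real\<times>real. D0v (fst p) (snd p) A) \<and>
          continuous_on UNIV (\<lambda>p::real\<times>real. D1u (fst p) (snd p) A) \<and>
          continuous_on UNIV (\<lambda>p::real\<times>real. D1v (fst p) (snd p) A)) \<and>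
      (\<forall>u v A. D0u u v A = D1v u v A \<and> D0v u v A = - D1u u v A))"

definition proximate_order :: "(real \<Rightarrow> real) \<Rightarrow> real \<Rightarrow> bool" where
  "proximate_order \<rho>r \<rho> \<longleftrightarrow> 0 < \<rho> \<and> (\<forall>r\<ge>0. 0 \<le> \<rho>r r) \<and>
     (\<exists>rd. (\<forall>r\<ge>0. (\<rho>r has_real_derivative rd r) (at r within {0..})) \<and>
            ((\<lambda>r. rd r * r * ln r) \<longlongrightarrow> 0) at_top) \<and>
     (\<rho>r \<longlongrightarrow> \<rho>) at_top"

definition normalized_po :: "(real \<Rightarrow> real) \<Rightarrow> bool" where
  "normalized_po \<rho>r \<longleftrightarrow> strict_mono_on {0<..} (\<lambda>r. r powr \<rho>r r) \<and>
     ((\<lambda>r. r powr \<rho>r r) \<longlongrightarrow> 0) (at_right 0)"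

definition po_inv :: "(real \<Rightarrow> real) \<Rightarrow> real \<Rightarrow> real" where
  "po_inv \<rho>r t = (THE r. 0 < r \<and> r powr \<rho>r r = t)"

definition A_class :: "nat \<Rightarrow> (real \<Rightarrow> real) \<Rightarrow> real \<Rightarrow> (cliff \<Rightarrow> cliff) set" where
  "A_class n \<rho>r \<sigma> = {f. SM_L n f \<and> (\<exists>M. \<forall>x\<in>paravec n.
      cl_norm n (f x) * exp (- \<sigma> * cl_norm n x powr \<rho>r (cl_norm n x)) \<le> M)}"

definition A_class_plus0 :: "nat \<Rightarrow> (real \<Rightarrow> real) \<Rightarrow> real \<Rightarrow> (cliff \<Rightarrow> cliff) set" where
  "A_class_plus0 n \<rho>r \<sigma> = (\<Inter>\<epsilon>\<in>{0<..}. A_class n \<rho>r (\<sigma> + \<epsilon>))"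

definition eln :: "real \<Rightarrow> ereal" where
  "eln t = (if t = 0 then -\<infinity> else ereal (ln t))"

end

theory Submission
  imports Defs
begin

text \<open>
  Write \<open>V r\<close> for \<open>r powr \<rho>r r\<close>. All four conditions are compared with: for every \<open>s > \<sigma>\<close>,
  \<open>|f(x)| \<le> M exp (s V |x|)\<close>. On a slice \<open>x = u + jv\<close> with \<open>z = u + iv\<close> one has
  \<open>x^l = Re (z^l) + j Im (z^l)\<close>, so \<open>f(x) + f(cnj x)\<close> is twice the cosine series
  \<open>\<Sum> a_l r^l cos (l \<theta>)\<close>, and its Fourier coefficients give the Cauchy estimate
  \<open>|a_l| r^l \<le> C max |f|\<close> over \<open>|x| = r\<close>.

  The logarithmic derivative of \<open>V\<close> in \<open>ln r\<close> tends to \<open>\<rho>\<close>, so \<open>V\<close> is regularly varying of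
  index \<open>\<rho>\<close>. Taking \<open>r = (\<rho> s) powr (- 1/\<rho>) * \<phi> l\<close> in the Cauchy estimate bounds the limsup of the
  coefficients. Conversely, with \<open>t = \<phi> l\<close> the bound on \<open>|a_l| r^l\<close> by \<open>q^l exp (s V r)\<close> becomes
  \<open>V t * (\<kappa> + ln (r/t)) \<le> s V r\<close>, which follows from \<open>V r \<ge> V t * (r/t) powr (\<rho> \<mp> \<eta>)\<close>
  and the tangent inequality for the exponential function.
\<close>

section \<open>Proximate orders and coefficient growth\<close>

locale normalized_proximate_order =
  fixes \<rho>r :: "real \<Rightarrow> real" and \<rho> :: real
  assumes po: "proximate_order \<rho>r \<rho>" and norm: "normalized_po \<rho>r"
begin

abbreviation V :: "real \<Rightarrow> real" where "V r \<equiv> r powr \<rho>r r"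
abbreviation \<phi> :: "real \<Rightarrow> real" where "\<phi> \<equiv> po_inv \<rho>r"

lemma rho_pos: "0 < \<rho>"
  using po by (simp add: proximate_order_def)

lemma rho_tendsto: "(\<rho>r \<longlongrightarrow> \<rho>) at_top"
  using po by (auto simp: proximate_order_def)

lemma rho_derivative:
  obtains rd where "\<And>r. 0 < r \<Longrightarrow> (\<rho>r has_real_derivative rd r) (at r)"
    "((\<lambda>r. rd r * r * ln r) \<longlongrightarrow> 0) at_top"
proof -
  obtain rd where rd: "\<forall>r\<ge>0. (\<rho>r has_real_derivative rd r) (at r within {0..})"
    "((\<lambda>r. rd r * r * ln r) \<longlongrightarrow> 0) at_top"
    using po by (auto simp: proximate_order_def)
  have "(\<rho>r has_real_derivative rd r) (at r)" if "0 < r" for r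
  proof -
    have "at r within {0..} = at r"
      using that by (intro at_within_interior) auto
    then show ?thesis using rd(1) that by (metis less_imp_le)
  qed
  then show thesis using rd(2) that by blast
qed

section \<open>Monotonicity, growth and inversion of \<open>V\<close>\<close>

lemma V_less: "0 < r \<Longrightarrow> r < t \<Longrightarrow> V r < V t"
  using norm by (auto simp: normalized_po_def strict_mono_on_def)

text \<open>Strict monotonicity is available only on the open half-line; the endpoint is covered
  because \<open>0 powr p = 0\<close> gives \<open>V 0 = 0\<close>.\<close>

lemma V_mono: "0 \<le> r \<Longrightarrow> r \<le> t \<Longrightarrow> V r \<le> V t"
  using V_less[of r t] by (cases "r = 0"; cases "r = t") auto

text \<open>Eventually the exponent exceeds \<open>\<rho>/2\<close>, and \<open>ln r\<close> is at
  most \<open>r powr (\<rho>/4)\<close> up to a factor. This crude bound suffices twice: it sends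
  \<open>V\<close> to infinity, and the square lets \<open>V\<close> beat every multiple of
  \<open>ln r\<close>.\<close>

lemma ln_squared_le_V: "\<forall>\<^sub>F r in at_top. (\<rho>/4)\<^sup>2 * (ln r)\<^sup>2 \<le> V r"
proof -
  have "\<forall>\<^sub>F r in at_top. \<rho>/2 < \<rho>r r"
    using rho_tendsto rho_pos by (intro order_tendstoD) auto
  with eventually_ge_at_top[of 1] show ?thesis
  proof eventually_elim
    case (elim r)
    have "\<rho>/4 * ln r \<le> r powr (\<rho>/4)"
      using ln_powr_bound[of r "\<rho>/4"] elim rho_pos by (simp add: field_simps)
    then have "(\<rho>/4 * ln r)\<^sup>2 \<le> (r powr (\<rho>/4))\<^sup>2"
      using elim rho_pos by (intro power_mono) auto
    also have "\<dots> = r powr (\<rho>/2)"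
      by (simp add: power2_eq_square flip: powr_add)
    also have "\<dots> \<le> V r"
      using elim by (intro powr_mono) auto
    finally show ?case by (simp add: power_mult_distrib power_divide)
  qed
qed

lemma V_at_top: "filterlim V at_top at_top"
proof (rule filterlim_at_top_mono)
  show "filterlim (\<lambda>r::real. (\<rho>/4)\<^sup>2 * (ln r)\<^sup>2) at_top at_top"
    using rho_pos
    by (intro filterlim_tendsto_pos_mult_at_top[OF tendsto_const]
        filterlim_pow_at_top ln_at_top) auto
qed (rule ln_squared_le_V)

lemma V_continuous: "0 < r \<Longrightarrow> isCont V r"
  by (rule rho_derivative) (auto intro!: continuous_powr dest!: DERIV_isCont)

lemma V_surj:
  assumes "0 < t" shows "\<exists>r>0. V r = t"
proof -
  have "\<forall>\<^sub>F r in at_right 0. V r < t"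
    using norm assms by (intro order_tendstoD) (auto simp: normalized_po_def)
  then obtain b where b: "b > 0" "\<And>r. 0 < r \<Longrightarrow> r < b \<Longrightarrow> V r < t"
    by (auto simp: eventually_at_right_field)
  have "\<forall>\<^sub>F r in at_top. t \<le> V r \<and> b \<le> r"
    using V_at_top by (auto simp: filterlim_at_top intro: eventually_conj eventually_ge_at_top)
  then obtain R where R: "t \<le> V R" "b \<le> R"
    by (auto simp: eventually_at_top_linorder)
  \<comment> \<open>\<open>V < t\<close> is known only on the open interval from \<open>0\<close> to
    \<open>b\<close>, hence the left end \<open>b/2\<close>; the bound \<open>b \<le> R\<close>
    keeps the ends in order.\<close>
  have "\<exists>r\<ge>b/2. r \<le> R \<and> V r = t"
    using b(1) b(2)[of "b/2"] R V_continuous by (intro IVT) auto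
  then show ?thesis using b(1) by (metis half_gt_zero less_le_trans)
qed

text \<open>Surjectivity and strict monotonicity make the \<open>THE\<close> in
  \<open>po_inv\<close> well defined at every positive \<open>t\<close>.\<close>

lemma phi:
  assumes "0 < t" shows "0 < \<phi> t" "V (\<phi> t) = t"
proof -
  have "\<exists>!r. 0 < r \<and> V r = t"
    using V_surj[OF assms] V_less by (metis less_irrefl linorder_neqE_linordered_idom)
  then have "0 < \<phi> t \<and> V (\<phi> t) = t"
    unfolding po_inv_def by (rule theI')
  then show "0 < \<phi> t" "V (\<phi> t) = t" by auto
qed

lemma phi_at_top: "filterlim \<phi> at_top at_top"
  unfolding filterlim_at_top
proof
  fix Z :: real
  have "\<forall>\<^sub>F t in at_top. V (max Z 1) < t" "\<forall>\<^sub>F t::real in at_top. 0 < t"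
    by (rule eventually_gt_at_top)+
  then show "\<forall>\<^sub>F t in at_top. Z \<le> \<phi> t"
  proof eventually_elim
    case (elim t)
    show ?case
    proof (rule ccontr)
      assume "\<not> ?case"
      then have "V (\<phi> t) \<le> V (max Z 1)"
        using phi[of t] elim by (intro V_mono) auto
      then show False using phi(2)[of t] elim by auto
    qed
  qed
qed

text \<open>A Potter-type bound, from the mean value theorem for
  \<^term>\<open>\<lambda>y. ln (V (exp y))\<close>, whose derivative tends to \<^term>\<open>\<rho>\<close>.\<close>

lemma potter:
  assumes "0 < \<eta>"
  obtains R where "1 \<le> R"
    "\<And>r t. R \<le> r \<Longrightarrow> R \<le> t \<Longrightarrow>
      \<bar>ln (V r) - ln (V t) - \<rho> * (ln r - ln t)\<bar> \<le> \<eta> * \<bar>ln r - ln t\<bar>"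
proof -
  obtain rd where rd: "\<And>r. 0 < r \<Longrightarrow> (\<rho>r has_real_derivative rd r) (at r)"
    "((\<lambda>r. rd r * r * ln r) \<longlongrightarrow> 0) at_top"
    using rho_derivative by blast
  \<comment> \<open>\<open>h\<close> is \<open>ln (V (exp y))\<close> with its linear main part
    \<open>\<rho> * y\<close> removed, so its derivative tends to \<open>0\<close> and
    \<open>h\<close> is Lipschitz with constant \<open>\<eta>\<close> far out.\<close>
  define h where "h y = \<rho>r (exp y) * y - \<rho> * y" for y
  define h' where "h' y = rd (exp y) * exp y * y + \<rho>r (exp y) - \<rho>" for y
  have lim: "((\<lambda>r. rd r * r * ln r + \<rho>r r - \<rho>) \<longlongrightarrow> 0 + \<rho> - \<rho>) at_top"
    by (intro tendsto_intros rd rho_tendsto)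
  have "\<forall>\<^sub>F r in at_top. \<bar>rd r * r * ln r + \<rho>r r - \<rho>\<bar> < \<eta>"
    using tendstoD[OF lim assms] by (simp add: dist_real_def)
  then obtain R0 where R0: "\<And>r. R0 \<le> r \<Longrightarrow> \<bar>rd r * r * ln r + \<rho>r r - \<rho>\<bar> < \<eta>"
    by (auto simp: eventually_at_top_linorder)
  define R where "R = max R0 1"
  have deriv: "(h has_real_derivative h' y) (at y within S)" for y S
    unfolding h_def h'_def
    by (rule derivative_eq_intros DERIV_chain2[OF rd(1)] refl | simp)+
  have bound: "norm (h x - h y) \<le> \<eta> * norm (x - y)"
    if "x \<in> {ln R..}" "y \<in> {ln R..}" for x y
  proof (rule field_differentiable_bound[OF convex_real_interval(1) deriv])
    fix z assume "z \<in> {ln R..}"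
    then have "exp (ln R) \<le> exp z" by simp
    then have "R \<le> exp z" by (simp add: R_def)
    then show "norm (h' z) \<le> \<eta>"
      using R0[of "exp z"] by (simp add: h'_def R_def)
  qed (use that in auto)
  show thesis
  proof (rule that[of R])
    show "1 \<le> R" by (simp add: R_def)
    fix r t assume rt: "R \<le> r" "R \<le> t"
    then have pos: "1 \<le> r" "1 \<le> t" by (auto simp: R_def)
    have "h (ln r) - h (ln t) = ln (V r) - ln (V t) - \<rho> * (ln r - ln t)"
      using pos by (simp add: h_def algebra_simps ln_powr)
    moreover have "ln r \<in> {ln R..}" "ln t \<in> {ln R..}"
      using rt by (auto simp: R_def)
    ultimately show "\<bar>ln (V r) - ln (V t) - \<rho> * (ln r - ln t)\<bar> \<le> \<eta> * \<bar>ln r - ln t\<bar>"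
      using bound by (metis real_norm_def)
  qed
qed

text \<open>The Potter bound for the pair \<open>c * t\<close>, \<open>t\<close> has the fixed
  logarithmic distance \<open>ln c\<close>, so its error is
  \<open>\<eta> * \<bar>ln c\<bar>\<close>, which is arbitrarily small.\<close>

lemma V_regular_variation:
  assumes "0 < c" shows "((\<lambda>t. V (c * t) / V t) \<longlongrightarrow> c powr \<rho>) at_top"
proof -
  have "((\<lambda>t. ln (V (c * t)) - ln (V t)) \<longlongrightarrow> \<rho> * ln c) at_top"
  proof (rule tendstoI)
    fix e :: real assume e: "0 < e"
    define \<eta> where "\<eta> = e / (2 * (\<bar>ln c\<bar> + 1))"
    have \<eta>: "0 < \<eta>" "\<eta> * \<bar>ln c\<bar> < e"
      using e by (auto simp: \<eta>_def field_simps add_nonneg_pos)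
    obtain R where R: "1 \<le> R" "\<And>r t. R \<le> r \<Longrightarrow> R \<le> t \<Longrightarrow>
      \<bar>ln (V r) - ln (V t) - \<rho> * (ln r - ln t)\<bar> \<le> \<eta> * \<bar>ln r - ln t\<bar>"
      using potter[OF \<eta>(1)] by blast
    show "\<forall>\<^sub>F t in at_top. dist (ln (V (c * t)) - ln (V t)) (\<rho> * ln c) < e"
      using eventually_ge_at_top[of R] eventually_ge_at_top[of "R / c"]
    proof eventually_elim
      case (elim t)
      then have "R \<le> c * t" using assms by (simp add: field_simps)
      from R(2)[OF this elim(1)] elim R(1) assms \<eta>(2)
      show ?case by (simp add: dist_real_def ln_mult)
    qed
  qed
  then have "((\<lambda>t. exp (ln (V (c * t)) - ln (V t))) \<longlongrightarrow> exp (\<rho> * ln c)) at_top"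
    by (rule tendsto_exp)
  moreover have "\<forall>\<^sub>F t in at_top. exp (ln (V (c * t)) - ln (V t)) = V (c * t) / V t"
    using eventually_gt_at_top[of 0] by eventually_elim (use assms in \<open>simp add: exp_diff del: ln_powr\<close>)
  ultimately show ?thesis
    using assms by (simp add: powr_def[of c] tendsto_cong)
qed

text \<open>Serves the finitely many low-order terms of a power series, which asymptotic coefficient
  bounds do not reach.\<close>

lemma power_le_exp_V:
  assumes "0 < s"
  obtains C where "0 \<le> C" "\<And>r. 0 \<le> r \<Longrightarrow> r ^ l \<le> C * exp (s * V r)"
proof -
  define c where "c = s * (\<rho>/4)\<^sup>2"
  have c: "0 < c" using assms rho_pos by (simp add: c_def)
  have "\<forall>\<^sub>F r::real in at_top. real l / c \<le> ln r"
    using ln_at_top by (simp add: filterlim_at_top)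
  with ln_squared_le_V eventually_gt_at_top[of 1]
  have "\<forall>\<^sub>F r in at_top. r ^ l \<le> exp (s * V r)"
  proof eventually_elim
    case (elim r)
    have "real l \<le> c * ln r" using elim c by (simp add: field_simps)
    then have "real l * ln r \<le> (c * ln r) * ln r"
      using elim by (intro mult_right_mono) auto
    also have "\<dots> = s * ((\<rho>/4)\<^sup>2 * (ln r)\<^sup>2)" by (simp add: c_def power2_eq_square)
    also have "\<dots> \<le> s * V r" using elim assms by (intro mult_left_mono) auto
    finally have "exp (real l * ln r) \<le> exp (s * V r)" by simp
    then show ?case using elim by (simp add: exp_of_nat_mult)
  qed
  then obtain R where R: "\<And>r. R \<le> r \<Longrightarrow> r ^ l \<le> exp (s * V r)"
    by (auto simp: eventually_at_top_linorder)
  \<comment> \<open>Below \<open>R\<close> the power is at most \<open>\<bar>R\<bar> ^ l\<close>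
    while the exponential is at least \<open>1\<close>; the summand \<open>1\<close> covers the
    range above \<open>R\<close>.\<close>
  define C where "C = 1 + \<bar>R\<bar> ^ l"
  show thesis
  proof (rule that[of C])
    show "0 \<le> C" by (simp add: C_def)
    fix r :: real assume r: "0 \<le> r"
    have e: "1 \<le> exp (s * V r)" using assms by simp
    show "r ^ l \<le> C * exp (s * V r)"
    proof (cases "R \<le> r")
      case True
      have "1 * exp (s * V r) \<le> C * exp (s * V r)"
        by (intro mult_right_mono) (auto simp: C_def)
      then show ?thesis using R[OF True] by (simp only: mult_1)
    next
      case False
      then have "r ^ l \<le> \<bar>R\<bar> ^ l" using r by (intro power_mono) auto
      also have "\<dots> \<le> C" by (simp add: C_def)
      also have "\<dots> \<le> C * exp (s * V r)" using mult_left_mono[OF e, of C] by (simp add: C_def)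
      finally show ?thesis .
    qed
  qed
qed

section \<open>Coefficient decay against exponential growth\<close>

definition K :: "real \<Rightarrow> real" where "K s = (exp 1 * \<rho> * s) powr (1 / \<rho>)"

lemma K_less: "0 \<le> s \<Longrightarrow> s < t \<Longrightarrow> K s < K t"
  using rho_pos by (simp add: K_def powr_less_mono2)

text \<open>Allows approximation of \<open>K s\<close> from above by values \<open>K t\<close> with
  \<open>t > s\<close>: a real \<open>z\<close> between \<open>K s\<close> and \<open>y\<close> is
  chosen and \<open>K\<close> is inverted at \<open>z\<close>.\<close>

lemma K_interpolate:
  assumes "0 \<le> s" "ereal (K s) < y"
  obtains t where "s < t" "ereal (K t) < y"
proof -
  obtain z where z: "K s < z" "ereal z < y"
    using ereal_dense2[OF assms(2)] by auto
  have K0: "0 \<le> K s" by (simp add: K_def)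
  define t where "t = z powr \<rho> / (exp 1 * \<rho>)"
  have "0 < z" using z K0 by linarith
  then have "K t = z" using rho_pos by (simp add: K_def t_def powr_powr)
  moreover have "s < t"
  proof -
    have "K s powr \<rho> < z powr \<rho>" using z K0 rho_pos by (intro powr_less_mono2) auto
    then show ?thesis using rho_pos assms by (simp add: K_def powr_powr t_def field_simps)
  qed
  ultimately show thesis using z that by auto
qed

text \<open>At \<open>r = c * \<phi> l\<close> the identity \<open>V (\<phi> l) = l\<close> turns
  the \<open>l\<close>-th root of \<open>exp (s * V r)\<close> into the exponential of
  \<open>s\<close> times a quotient of values of \<open>V\<close>, to which regular variation
  applies.\<close>

lemma Limsup_root_le_of_growth:
  assumes b: "\<And>l. 0 \<le> b l" and "0 < s" and C: "0 < C"
    and growth: "\<And>l r. 1 \<le> l \<Longrightarrow> 0 < r \<Longrightarrow> b l * r ^ l \<le> C * exp (s * V r)"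
  shows "limsup (\<lambda>l. ereal (root l (b l) * \<phi> (real l))) \<le> ereal (K s)"
proof -
  \<comment> \<open>The limit obtained for a general factor \<open>c\<close> is
    \<open>exp (s * c powr \<rho>) / c\<close>; this \<open>c\<close> is its minimizer, and the
    minimum is \<open>K s\<close>.\<close>
  define c where "c = (1 / (\<rho> * s)) powr (1 / \<rho>)"
  have c: "0 < c" "c powr \<rho> = 1 / (\<rho> * s)"
    using rho_pos assms(2) by (auto simp: c_def powr_powr)
  define u where "u l = root l C * exp (s * (V (c * \<phi> (real l)) / V (\<phi> (real l)))) / c" for l
  have "filterlim (\<lambda>l. \<phi> (real l)) at_top sequentially"
    by (rule filterlim_compose[OF phi_at_top filterlim_real_sequentially])
  then have "u \<longlonglongrightarrow> 1 * exp (s * c powr \<rho>) / c"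
    unfolding u_def
    by (intro tendsto_intros LIMSEQ_root_const C
        filterlim_compose[OF V_regular_variation]) (use c in auto)
  also have "1 * exp (s * c powr \<rho>) / c = K s"
    using rho_pos assms(2)
    by (simp add: c(2)) (simp add: c_def K_def powr_mult powr_divide exp_powr_real)
  finally have u: "u \<longlonglongrightarrow> K s" .
  have le: "root l (b l) * \<phi> (real l) \<le> u l" if "1 \<le> l" for l
  proof -
    define r where "r = c * \<phi> (real l)"
    have \<phi>: "0 < \<phi> (real l)" "V (\<phi> (real l)) = real l" using phi[of "real l"] that by auto
    have r: "0 < r" using \<phi> c by (simp add: r_def)
    have "root l (b l * r ^ l) \<le> root l (C * exp (s * V r))"
      using growth[OF that r] that by simp
    moreover have "root l (b l * r ^ l) = root l (b l) * r"
      using that r by (simp add: real_root_mult real_root_power_cancel)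
    moreover have "root l (exp (s * V r)) = exp (s * V r / real l)"
      using that by (simp add: root_powr_inverse exp_powr_real divide_inverse)
    ultimately have "root l (b l) * r \<le> root l C * exp (s * V r / real l)"
      by (metis real_root_mult)
    then show ?thesis
      using c(1) \<phi> unfolding u_def by (simp add: r_def pos_le_divide_eq mult_ac)
  qed
  have "limsup (\<lambda>l. ereal (root l (b l) * \<phi> (real l))) \<le> limsup (\<lambda>l. ereal (u l))"
    by (intro Limsup_mono eventually_mono[OF eventually_ge_at_top[of 1]]) (simp add: le)
  also have "\<dots> = ereal (K s)"
    by (intro lim_imp_Limsup tendsto_ereal u) auto
  finally show ?thesis .
qed

text \<open>The strict gap between \<open>\<sigma>\<close> and \<open>s\<close> is spent on the
  factor \<open>q ^ l\<close>, which later makes the terms summable uniformly in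
  \<open>r\<close>.\<close>

lemma growth_of_Limsup_root_le:
  assumes b: "\<And>l. 0 \<le> b l" and "0 \<le> \<sigma>" "\<sigma> < s"
    and lim: "limsup (\<lambda>l. ereal (root l (b l) * \<phi> (real l))) \<le> ereal (K \<sigma>)"
  obtains M q where "0 \<le> M" "0 < q" "q < 1"
    "\<And>l r. 0 \<le> r \<Longrightarrow> b l * r ^ l \<le> M * q ^ l * exp (s * V r)"
proof -
  have s: "0 < s" using assms by simp
  obtain s1 where s1: "\<sigma> < s1" "s1 < s" using dense[OF assms(3)] by blast
  have "\<forall>\<^sub>F l in sequentially. ereal (root l (b l) * \<phi> (real l)) < ereal (K s1)"
    using lim K_less[OF assms(2) s1(1)] unfolding Limsup_le_iff by (metis less_ereal.simps(1))
  then have ev1: "\<forall>\<^sub>F l in sequentially. root l (b l) * \<phi> (real l) < K s1" by simp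
  \<comment> \<open>For \<open>p > 0\<close>, \<open>g p\<close> is the minimum over real
    \<open>x\<close> of \<open>s * exp (p * x) - x\<close>, hence the best constant in the tangent
    inequality below; at \<open>p = \<rho>\<close> it equals \<open>ln (K s)\<close>.\<close>
  define g where "g p = (1 + ln (s * p)) / p" for p
  have g\<rho>: "g \<rho> = ln (K s)"
    using rho_pos s by (simp add: g_def K_def ln_mult)
  have K1: "0 < K s1" "K s1 < K s"
    using s1 assms(2) K_less[of s1 s] rho_pos by (auto simp: K_def)
  then have "ln (K s1) < ln (K s)" by simp
  then obtain \<kappa> where \<kappa>: "ln (K s1) < \<kappa>" "\<kappa> < g \<rho>" using dense g\<rho> by metis
  \<comment> \<open>Continuity leaves room to replace \<open>\<rho>\<close> by
    \<open>\<rho> + \<eta>\<close> and \<open>\<rho> - \<eta>\<close>, the exponents that the Potter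
    bound supplies.\<close>
  have "isCont g \<rho>"
    using rho_pos s unfolding g_def by (intro continuous_intros) auto
  then have "\<forall>\<^sub>F p in nhds \<rho>. \<kappa> < g p"
    using \<kappa> by (intro order_tendstoD) (auto simp: isCont_def tendsto_at_iff_tendsto_nhds)
  then obtain d where d: "0 < d" "\<And>p. dist p \<rho> < d \<Longrightarrow> \<kappa> < g p"
    by (auto simp: eventually_nhds_metric)
  define \<eta> where "\<eta> = min (d/2) (\<rho>/2)"
  have \<eta>: "0 < \<eta>" "\<eta> < \<rho>" "\<kappa> < g (\<rho> + \<eta>)" "\<kappa> < g (\<rho> - \<eta>)"
    using d rho_pos by (auto simp: \<eta>_def dist_real_def intro!: d)
  have tangent: "\<kappa> + x \<le> s * exp (p * x)" if "0 < p" "\<kappa> < g p" for p x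
  proof -
    have "1 + (p * x + ln (s * p)) \<le> exp (p * x + ln (s * p))" by (rule exp_ge_add_one_self)
    also have "\<dots> = p * (s * exp (p * x))" using that s by (simp add: exp_add)
    finally have "(1 + ln (s * p)) / p + x \<le> s * exp (p * x)"
      using that by (simp add: field_simps)
    then show ?thesis using that by (simp add: g_def)
  qed
  obtain R where R: "1 \<le> R" "\<And>r t. R \<le> r \<Longrightarrow> R \<le> t \<Longrightarrow>
      \<bar>ln (V r) - ln (V t) - \<rho> * (ln r - ln t)\<bar> \<le> \<eta> * \<bar>ln r - ln t\<bar>"
    using potter[OF \<eta>(1)] by blast
  \<comment> \<open>The first entry makes the Potter bound applicable at \<open>t\<close>; the
    second gives \<open>\<kappa> + ln R \<le> ln t\<close>, so for \<open>r < R\<close> the left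
    side of \<open>key\<close> is at most \<open>0\<close>.\<close>
  define T where "T = max R (exp \<kappa> * R)"
  have key: "V t * (\<kappa> + (ln r - ln t)) \<le> s * V r" if t: "T \<le> t" and r: "0 < r" for r t
  proof -
    have t0: "0 < t" "R \<le> t" "exp \<kappa> * R \<le> t" using t R(1) by (auto simp: T_def)
    show ?thesis
    proof (cases "R \<le> r")
      case False
      have "ln (exp \<kappa> * R) \<le> ln t" using t0 R(1) by (subst ln_le_cancel_iff) auto
      moreover have "ln r \<le> ln R" using False r R(1) by auto
      ultimately have "\<kappa> + (ln r - ln t) \<le> 0" using R(1) by (simp add: ln_mult)
      then have "V t * (\<kappa> + (ln r - ln t)) \<le> 0" by (intro mult_nonneg_nonpos) auto
      also have "0 \<le> s * V r" using s by simp
      finally show ?thesis .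
    next
      case True
      define x where "x = ln r - ln t"
      have w: "\<bar>ln (V r) - ln (V t) - \<rho> * x\<bar> \<le> \<eta> * \<bar>x\<bar>"
        using R(2)[OF True t0(2)] by (simp add: x_def)
      \<comment> \<open>The lower Potter bound \<open>\<rho> * x - \<eta> * \<bar>x\<bar>\<close> is
        \<open>p * x\<close> with an exponent depending on the sign of \<open>x\<close>.\<close>
      define p where "p = (if 0 \<le> x then \<rho> - \<eta> else \<rho> + \<eta>)"
      have "p * x \<le> ln (V r) - ln (V t)"
        using w by (auto simp: p_def algebra_simps split: if_splits)
      then have "exp (p * x) \<le> exp (ln (V r) - ln (V t))" by simp
      also have "\<dots> = V r / V t" using r t0 by (simp add: exp_diff del: ln_powr)
      finally have "s * exp (p * x) \<le> s * (V r / V t)" using s by (intro mult_left_mono) auto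
      moreover have "\<kappa> + x \<le> s * exp (p * x)"
        using \<eta> rho_pos by (intro tangent) (auto simp: p_def)
      ultimately have "\<kappa> + x \<le> s * V r / V t" by simp
      then show ?thesis using t0 by (simp add: x_def field_simps)
    qed
  qed
  define q where "q = exp (ln (K s1) - \<kappa>)"
  have q: "0 < q" "q < 1" using \<kappa> by (auto simp: q_def)
  have "filterlim (\<lambda>l. \<phi> (real l)) at_top sequentially"
    by (rule filterlim_compose[OF phi_at_top filterlim_real_sequentially])
  then have "\<forall>\<^sub>F l in sequentially. T \<le> \<phi> (real l)" by (simp add: filterlim_at_top)
  with ev1 eventually_ge_at_top[of 1]
  have "\<forall>\<^sub>F l in sequentially. \<forall>r\<ge>0. b l * r ^ l \<le> q ^ l * exp (s * V r)"
  proof eventually_elim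
    case (elim l)
    define t where "t = \<phi> (real l)"
    have t: "0 < t" "V t = real l" using phi[of "real l"] elim by (auto simp: t_def)
    have "root l (b l) \<le> K s1 / t" using elim t by (simp add: t_def field_simps)
    then have "root l (b l) ^ l \<le> (K s1 / t) ^ l" using b elim by (intro power_mono) auto
    then have bl: "b l \<le> (K s1 / t) ^ l" using b[of l] elim by simp
    show ?case
    proof (intro allI impI)
      fix r :: real assume "0 \<le> r"
      show "b l * r ^ l \<le> q ^ l * exp (s * V r)"
      proof (cases "r = 0")
        case True
        then show ?thesis using elim q by (simp add: power_0_left)
      next
        case False
        with \<open>0 \<le> r\<close> have r: "0 < r" by simp
        \<comment> \<open>Splitting off \<open>q\<close> leaves \<open>exp (\<kappa> + x)\<close>
          with \<open>x = ln r - ln t\<close>; since \<open>l = V t\<close>, its \<open>l\<close>-th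
          power is \<open>exp (V t * (\<kappa> + x))\<close>, exactly what \<open>key\<close>
          bounds.\<close>
        have "K s1 / t * r = q * exp (\<kappa> + (ln r - ln t))"
          using K1 r t by (simp add: q_def exp_diff exp_add field_simps)
        then have "(K s1 / t) ^ l * r ^ l = q ^ l * exp (\<kappa> + (ln r - ln t)) ^ l"
          by (simp flip: power_mult_distrib)
        also have "exp (\<kappa> + (ln r - ln t)) ^ l = exp (V t * (\<kappa> + (ln r - ln t)))"
          by (simp only: t exp_of_nat_mult)
        also have "q ^ l * \<dots> \<le> q ^ l * exp (s * V r)"
          using key[of t r] elim r q by (intro mult_left_mono) (auto simp: t_def)
        finally show ?thesis
          using r by (intro order_trans[OF mult_right_mono[OF bl]]) auto
      qed
    qed
  qed
  then obtain L where L: "\<And>l r. L \<le> l \<Longrightarrow> 0 \<le> r \<Longrightarrow> b l * r ^ l \<le> q ^ l * exp (s * V r)"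
    by (auto simp: eventually_sequentially)
  have "\<forall>l. \<exists>C\<ge>0. \<forall>r\<ge>0. r ^ l \<le> C * exp (s * V r)"
    using power_le_exp_V[OF s] by metis
  then obtain C where C: "\<And>l. 0 \<le> C l" "\<And>l r. 0 \<le> r \<Longrightarrow> r ^ l \<le> C l * exp (s * V r)"
    by metis
  \<comment> \<open>The sum absorbs the indices below \<open>L\<close>, each divided by
    \<open>q ^ l\<close> to restore the geometric factor; the summand \<open>1\<close> serves the
    indices from \<open>L\<close> on.\<close>
  define M where "M = 1 + (\<Sum>l<L. b l * C l / q ^ l)"
  have nn: "0 \<le> b l * C l / q ^ l" for l using b C(1) q by simp
  have M1: "1 \<le> M" using nn by (simp add: M_def sum_nonneg)
  show thesis
  proof (rule that[of M q])
    fix l and r :: real assume r: "0 \<le> r"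
    show "b l * r ^ l \<le> M * q ^ l * exp (s * V r)"
    proof (cases "L \<le> l")
      case True
      have "1 * (q ^ l * exp (s * V r)) \<le> M * (q ^ l * exp (s * V r))"
        using M1 q by (intro mult_right_mono) auto
      then show ?thesis using L[OF True r] by simp
    next
      case False
      have "b l * C l / q ^ l \<le> M"
        using member_le_sum[of l "{..<L}" "\<lambda>l. b l * C l / q ^ l"] nn False by (simp add: M_def)
      then have "b l * C l \<le> M * q ^ l" using q by (simp add: field_simps)
      then have "b l * C l * exp (s * V r) \<le> M * q ^ l * exp (s * V r)"
        by (intro mult_right_mono) auto
      moreover have "b l * r ^ l \<le> b l * (C l * exp (s * V r))"
        using C(2)[OF r] b by (intro mult_left_mono) auto
      ultimately show ?thesis unfolding mult.assoc[of "b l" "C l", symmetric] by (rule order_trans[rotated])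
    qed
  qed (use M1 q in auto)
qed

end

section \<open>A coefficient bound for cosine series\<close>

text \<open>The frequency is an integer because the product formula for cosines produces
  \<open>l - m\<close> as well as \<open>l + m\<close>.\<close>

lemma integral_cos_int_mult:
  "((\<lambda>x. cos (of_int k * x)) has_integral (if k = 0 then pi else 0)) {0..pi}"
proof (cases "k = 0")
  case False
  have "((\<lambda>x. cos (of_int k * x)) has_integral
      sin (of_int k * pi) / of_int k - sin (of_int k * 0) / of_int k) {0..pi}"
    using False
    by (intro fundamental_theorem_of_calculus)
       (auto intro!: derivative_eq_intros simp flip: has_real_derivative_iff_has_vector_derivative)
  moreover have "sin (of_int k * pi) = 0" by (auto simp: sin_zero_iff_int2)
  ultimately show ?thesis using False by simp
next
  case True
  then show ?thesis using has_integral_const_real[of "1::real" 0 pi] by simp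
qed

text \<open>Positivity of \<open>m\<close> keeps \<open>l + m\<close> away from \<open>0\<close>, so
  only the difference frequency can contribute.\<close>

lemma integral_cos_mult_cos:
  assumes "0 < m"
  shows "((\<lambda>x. cos (real l * x) * cos (real m * x)) has_integral (if l = m then pi / 2 else 0)) {0..pi}"
proof -
  have "((\<lambda>x. (cos (of_int (int l - int m) * x) + cos (of_int (int l + int m) * x)) / 2) has_integral
      ((if int l - int m = 0 then pi else 0) + (if int l + int m = 0 then pi else 0)) / 2) {0..pi}"
    by (intro has_integral_divide has_integral_add integral_cos_int_mult)
  then show ?thesis
    using assms by (auto simp: cos_times_cos ring_distribs mult_ac)
qed

text \<open>Absolute summability gives uniform convergence, so the series times
  \<open>cos (m * x)\<close> may be integrated termwise over half a period. This yields
  \<open>c m * (pi / 2)\<close>, while the integrand is bounded by \<open>M\<close> on an interval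
  of length \<open>pi\<close>.\<close>

lemma cosine_series_coeff_bound:
  fixes c :: "nat \<Rightarrow> real"
  assumes sums: "\<And>x. (\<lambda>l. c l * cos (real l * x)) sums h x"
    and abs: "summable (\<lambda>l. \<bar>c l\<bar>)" and M: "\<And>x. \<bar>h x\<bar> \<le> M" and "0 < m"
  shows "\<bar>c m\<bar> \<le> 2 * M"
proof -
  define S where "S N x = (\<Sum>l<N. c l * cos (real l * x) * cos (real m * x))" for N x
  have "uniform_limit {0..pi} S (\<lambda>x. \<Sum>l. c l * cos (real l * x) * cos (real m * x)) sequentially"
    unfolding S_def using abs
  proof (intro Weierstrass_m_test)
    fix l x
    have "\<bar>cos (real l * x)\<bar> * \<bar>cos (real m * x)\<bar> \<le> 1 * 1" by (intro mult_mono) auto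
    then show "norm (c l * cos (real l * x) * cos (real m * x)) \<le> \<bar>c l\<bar>"
      by (simp add: abs_mult mult.assoc mult_left_le)
  qed
  moreover have "(\<Sum>l. c l * cos (real l * x) * cos (real m * x)) = h x * cos (real m * x)" for x
    using sums_mult2[OF sums] by (rule sums_unique[symmetric])
  ultimately have "uniform_limit {0..pi} S (\<lambda>x. h x * cos (real m * x)) sequentially"
    by simp
  moreover have "continuous_on {0..pi} (S N)" for N
    unfolding S_def by (intro continuous_intros)
  ultimately obtain I J where I: "\<And>N. (S N has_integral I N) {0..pi}"
    and J: "((\<lambda>x. h x * cos (real m * x)) has_integral J) {0..pi}" and IJ: "I \<longlonglongrightarrow> J"
    by (rule uniform_limit_integral) auto
  have "(S N has_integral (\<Sum>l<N. c l * (if l = m then pi / 2 else 0))) {0..pi}" for N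
    unfolding S_def mult.assoc using \<open>0 < m\<close>
    by (intro has_integral_sum has_integral_mult_right integral_cos_mult_cos) auto
  then have "I N = (\<Sum>l<N. c l * (if l = m then pi / 2 else 0))" for N
    using I has_integral_unique by blast
  also have "(\<Sum>l<N. c l * (if l = m then pi / 2 else 0)) = (if m < N then c m * (pi / 2) else 0)" for N
    by (simp add: if_distrib[of "\<lambda>x. c _ * x"] cong: if_cong)
  finally have "\<forall>\<^sub>F N in sequentially. I N = c m * (pi / 2)"
    by (intro eventually_mono[OF eventually_gt_at_top[of m]]) auto
  then have "J = c m * (pi / 2)"
    using IJ LIMSEQ_unique tendsto_eventually by blast
  moreover have "norm J \<le> M * measure lborel (cbox 0 pi)"
  proof (rule has_integral_bound)
    show "0 \<le> M" using M[of 0] by linarith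
    fix x
    have "\<bar>h x\<bar> * \<bar>cos (real m * x)\<bar> \<le> M * 1" using M by (intro mult_mono) (auto intro: order_trans[OF abs_ge_zero])
    then show "norm (h x * cos (real m * x)) \<le> M" by (simp add: abs_mult)
  qed (use J in simp)
  ultimately have "\<bar>c m * (pi / 2)\<bar> \<le> M * pi" by simp
  then have "\<bar>c m\<bar> * (pi / 2) \<le> (2 * M) * (pi / 2)" by (simp add: abs_mult)
  then show ?thesis by (rule mult_right_le_imp_le) simp
qed

section \<open>Powers of paravectors\<close>

lemma cl_norm_eq_L2_set: "cl_norm n a = L2_set a (Pow {1..n})"
  by (simp add: cl_norm_def L2_set_def)

lemma cl_norm_nonneg: "0 \<le> cl_norm n a"
  by (simp add: cl_norm_eq_L2_set)

lemma abs_le_cl_norm: "A \<subseteq> {1..n} \<Longrightarrow> \<bar>a A\<bar> \<le> cl_norm n a"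
  using member_le_L2_set[of "Pow {1..n}" A "\<lambda>A. \<bar>a A\<bar>"]
  by (auto simp: cl_norm_def L2_set_def)

text \<open>The factor \<open>2 ^ n\<close> counts the basis blades. Such crude constants are
  harmless, since the growth conditions ignore constant factors.\<close>

lemma cl_norm_le:
  assumes "\<And>A. A \<subseteq> {1..n} \<Longrightarrow> \<bar>a A\<bar> \<le> M"
  shows "cl_norm n a \<le> 2 ^ n * M"
proof -
  have "cl_norm n a \<le> (\<Sum>A\<in>Pow {1..n}. \<bar>a A\<bar>)"
    unfolding cl_norm_eq_L2_set by (rule L2_set_le_sum_abs)
  also have "\<dots> \<le> real (card (Pow {1..n})) * M"
    by (rule sum_bounded_above) (use assms in auto)
  finally show ?thesis by (simp add: card_Pow)
qed

text \<open>Phrased for the combination \<open>a + t b\<close> because \<open>para\<close> has this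
  shape.\<close>

lemma cl_mult_linear_left:
  "cl_mult n (\<lambda>A. a A + t * b A) c = (\<lambda>A. cl_mult n a c A + t * cl_mult n b c A)"
  unfolding cl_mult_def sum_distrib_left sum.distrib[symmetric]
  by (intro ext sum.cong refl) (auto simp: algebra_simps)

lemma cl_mult_linear_right:
  "cl_mult n c (\<lambda>A. a A + t * b A) = (\<lambda>A. cl_mult n c a A + t * cl_mult n c b A)"
  unfolding cl_mult_def sum_distrib_left sum.distrib[symmetric]
  by (intro ext sum.cong refl) (auto simp: algebra_simps)

lemma abs_cl_sign [simp]: "\<bar>cl_sign A B\<bar> = 1"
  by (simp add: cl_sign_def power_abs)

lemma cl_sign_empty [simp]: "cl_sign {} B = 1" "cl_sign A {} = 1"
  by (simp_all add: cl_sign_def)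

lemma cl_mult_real_left:
  assumes "b \<in> clifford n" shows "cl_mult n (cl_real t) b = (\<lambda>A. t * b A)"
proof
  fix C
  have "cl_mult n (cl_real t) b C =
    (\<Sum>A\<in>Pow {1..n}. if A = {} then \<Sum>B\<in>Pow {1..n}. if B = C then t * b B else 0 else 0)"
    unfolding cl_mult_def
  proof (intro sum.cong refl)
    fix A
    show "(\<Sum>B\<in>Pow {1..n}. if A - B \<union> (B - A) = C then cl_sign A B * cl_real t A * b B else 0) =
        (if A = {} then \<Sum>B\<in>Pow {1..n}. if B = C then t * b B else 0 else 0)"
      by (cases "A = {}") (simp_all add: cl_real_def cong: if_cong)
  qed
  then show "cl_mult n (cl_real t) b C = t * b C"
    using assms by (auto simp: clifford_def)
qed

lemma cl_mult_real_right:
  assumes "a \<in> clifford n" shows "cl_mult n a (cl_real t) = (\<lambda>A. t * a A)"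
proof
  fix C
  have "cl_mult n a (cl_real t) C =
    (\<Sum>A\<in>Pow {1..n}. \<Sum>B\<in>Pow {1..n}. if B = {} then if A = C then t * a A else 0 else 0)"
    unfolding cl_mult_def by (intro sum.cong refl) (auto simp: cl_real_def)
  then show "cl_mult n a (cl_real t) C = t * a C"
    using assms by (auto simp: clifford_def)
qed

text \<open>There are \<open>4 ^ n\<close> pairs of blades, and each contributes at most the product
  of the norms because signs have modulus \<open>1\<close>.\<close>

lemma cl_mult_bound: "\<bar>cl_mult n a b C\<bar> \<le> 4 ^ n * (cl_norm n a * cl_norm n b)"
proof -
  have "\<bar>cl_mult n a b C\<bar> \<le> (\<Sum>A\<in>Pow {1..n}. \<Sum>B\<in>Pow {1..n}. cl_norm n a * cl_norm n b)"
    unfolding cl_mult_def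
  proof (rule order_trans[OF sum_abs sum_mono], rule order_trans[OF sum_abs sum_mono])
    fix A B assume "A \<in> Pow {1..n}" "B \<in> Pow {1..n}"
    then have "\<bar>a A\<bar> * \<bar>b B\<bar> \<le> cl_norm n a * cl_norm n b"
      by (intro mult_mono abs_le_cl_norm) (auto simp: cl_norm_nonneg)
    then show "\<bar>if A - B \<union> (B - A) = C then cl_sign A B * a A * b B else 0\<bar>
        \<le> cl_norm n a * cl_norm n b"
      by (auto simp: abs_mult intro: order_trans[rotated])
  qed
  also have "\<dots> = 4 ^ n * (cl_norm n a * cl_norm n b)"
    by (simp add: card_Pow flip: mult.assoc power_mult_distrib)
  finally show ?thesis .
qed

section \<open>Imaginary units and complex slices\<close>

lemma unit_sphere_eq_0:
  assumes "j \<in> unit_sphere n" "A \<notin> (\<lambda>k. {k}) ` {1..n}" shows "j A = 0"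
proof (cases "A \<subseteq> {1..n} \<and> A \<noteq> {}")
  case True
  then have "finite A" using finite_subset by blast
  have "2 \<le> card A"
  proof (rule ccontr)
    assume "\<not> 2 \<le> card A"
    moreover have "card A \<noteq> 0" using True \<open>finite A\<close> by simp
    ultimately have "card A = 1" by linarith
    then obtain k where "A = {k}" by (auto simp: card_1_singleton_iff)
    then show False using True assms by auto
  qed
  then show ?thesis using assms by (auto simp: unit_sphere_def paravec_def)
qed (use assms in \<open>auto simp: unit_sphere_def paravec_def clifford_def\<close>)

lemma sum_Pow_singletons:
  assumes "\<And>A. A \<in> Pow {1..n} \<Longrightarrow> A \<notin> (\<lambda>k. {k}) ` {1..n} \<Longrightarrow> g A = 0"
  shows "sum g (Pow {1..n}) = (\<Sum>k\<in>{1..n::nat}. g {k})"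
proof -
  have "sum g (Pow {1..n}) = sum g ((\<lambda>k. {k}) ` {1..n})"
    by (rule sum.mono_neutral_right) (use assms in auto)
  then show ?thesis by (simp add: sum.reindex)
qed

text \<open>The products of distinct generators cancel in pairs, so only the squares contribute.\<close>

lemma unit_sphere_square:
  assumes j: "j \<in> unit_sphere n" shows "cl_mult n j j = cl_real (- 1)"
proof
  fix C
  define F where "F A B = (if A - B \<union> (B - A) = C then cl_sign A B * j A * j B else 0)" for A B
  define T where "T k m = F {k} {m}" for k m
  have F0: "F A B = 0" if "A \<notin> (\<lambda>k. {k}) ` {1..n} \<or> B \<notin> (\<lambda>k. {k}) ` {1..n}" for A B
    using that unit_sphere_eq_0[OF j] by (auto simp: F_def)
  have "cl_mult n j j C = (\<Sum>A\<in>Pow {1..n}. \<Sum>B\<in>Pow {1..n}. F A B)"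
    by (simp only: cl_mult_def F_def)
  also have "\<dots> = (\<Sum>k\<in>{1..n}. \<Sum>B\<in>Pow {1..n}. F {k} B)"
    by (rule sum_Pow_singletons) (intro sum.neutral ballI F0, blast)
  also have "\<dots> = (\<Sum>k\<in>{1..n}. \<Sum>m\<in>{1..n}. T k m)"
    unfolding T_def by (intro sum.cong refl sum_Pow_singletons F0) blast
  finally have "cl_mult n j j C = (\<Sum>k\<in>{1..n}. \<Sum>m\<in>{1..n}. T k m)" .
  \<comment> \<open>Adding the double sum to its transpose pairs \<open>T k m\<close> with
    \<open>T m k\<close>, which are opposite off the diagonal.\<close>
  moreover have "(\<Sum>k\<in>{1..n}. \<Sum>m\<in>{1..n}. T k m) = (\<Sum>k\<in>{1..n}. \<Sum>m\<in>{1..n}. T m k)"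
    by (rule sum.swap)
  ultimately have "2 * cl_mult n j j C = (\<Sum>k\<in>{1..n}. \<Sum>m\<in>{1..n}. T k m + T m k)"
    by (simp add: sum.distrib)
  also have "\<dots> = (\<Sum>k\<in>{1..n}. \<Sum>m\<in>{1..n}. if m = k then 2 * T k k else 0)"
  proof (intro sum.cong refl)
    fix k m :: nat
    have "{(a, b). a = k \<and> b = m \<and> b < a} = (if m < k then {(k, m)} else {})" for k m :: nat
      by auto
    then have "cl_sign {k} {m} = - cl_sign {m} {k}" if "k \<noteq> m"
      using that by (auto simp: cl_sign_def)
    then show "T k m + T m k = (if m = k then 2 * T k k else 0)"
      by (auto simp: T_def F_def Un_commute)
  qed
  also have "\<dots> = 2 * (\<Sum>k\<in>{1..n}. T k k)"
    by (simp add: sum_distrib_left)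
  also have "(\<Sum>k\<in>{1..n}. T k k) = (if C = {} then - (\<Sum>k\<in>{1..n}. (j {k})\<^sup>2) else 0)"
  proof -
    \<comment> \<open>On the diagonal there is no inversion; the sign comes from the intersection
      term in \<open>cl_sign\<close>.\<close>
    have "{(a, b). a \<in> {k} \<and> b \<in> {k} \<and> b < a} = {}" for k :: nat by auto
    then have "cl_sign {k} {k} = - 1" for k by (simp only: cl_sign_def) simp
    then show ?thesis by (auto simp: T_def F_def power2_eq_square sum_negf)
  qed
  finally show "cl_mult n j j C = cl_real (- 1) C"
    using j by (simp add: unit_sphere_def cl_real_def split: if_splits)
qed

lemma unit_sphere_clifford: "j \<in> unit_sphere n \<Longrightarrow> j \<in> clifford n"
  by (simp add: unit_sphere_def paravec_def)

lemma para_clifford: "j \<in> unit_sphere n \<Longrightarrow> para u v j \<in> clifford n"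
  using unit_sphere_clifford by (auto simp: para_def clifford_def cl_real_def)

lemma para_paravec: "j \<in> unit_sphere n \<Longrightarrow> para u v j \<in> paravec n"
  using para_clifford[of j n u v] by (auto simp: paravec_def para_def cl_real_def unit_sphere_def)

lemma cl_mult_para:
  assumes "b \<in> clifford n"
  shows "cl_mult n (para u v j) b = (\<lambda>A. u * b A + v * cl_mult n j b A)"
  unfolding para_def cl_mult_linear_left cl_mult_real_left[OF assms] ..

text \<open>As \<open>j\<close> squares to \<open>-1\<close>, sending \<open>u + iv\<close> to
  \<open>u + jv\<close> is multiplicative, so powers can be computed in the complex plane.\<close>

lemma cl_pow_para:
  assumes j: "j \<in> unit_sphere n"
  shows "cl_pow n (para (Re z) (Im z) j) l = para (Re (z ^ l)) (Im (z ^ l)) j"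
proof (induction l)
  case (Suc l)
  have "cl_mult n j (\<lambda>A. cl_real p A + q * j A) = (\<lambda>A. p * j A + q * cl_real (- 1) A)" for p q
    unfolding cl_mult_linear_right unit_sphere_square[OF j]
      cl_mult_real_right[OF unit_sphere_clifford[OF j]] ..
  then have "cl_mult n j (para p q j) = (\<lambda>A. p * j A + q * cl_real (- 1) A)" for p q
    by (simp add: para_def)
  then have "cl_mult n (para u v j) (para p q j) = para (u * p - v * q) (u * q + v * p) j" for u v p q
    unfolding cl_mult_para[OF para_clifford[OF j]]
    by (auto simp: para_def cl_real_def algebra_simps)
  with Suc show ?case by simp
qed (simp add: para_def)

text \<open>The scalar part and \<open>j\<close> live on disjoint blades and \<open>j\<close> has
  norm \<open>1\<close>, so the squares add up as for a complex number.\<close>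

lemma cl_norm_para:
  assumes j: "j \<in> unit_sphere n"
  shows "cl_norm n (para (Re z) (Im z) j) = cmod z"
proof -
  have "(\<Sum>A\<in>Pow {1..n}. (para (Re z) (Im z) j A)\<^sup>2)
      = (\<Sum>A\<in>Pow {1..n}. (cl_real (Re z) A)\<^sup>2 + (Im z)\<^sup>2 * (j A)\<^sup>2)"
    using j by (intro sum.cong refl)
      (auto simp: para_def cl_real_def unit_sphere_def power_mult_distrib)
  also have "\<dots> = (\<Sum>A\<in>Pow {1..n}. if A = {} then (Re z)\<^sup>2 else 0)
      + (Im z)\<^sup>2 * (\<Sum>A\<in>Pow {1..n}. (j A)\<^sup>2)"
    unfolding sum.distrib sum_distrib_left
    by (intro arg_cong2[of _ _ _ _ "(+)"] sum.cong refl) (auto simp: cl_real_def)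
  also have "(\<Sum>A\<in>Pow {1..n}. (j A)\<^sup>2) = 1"
    using j by (subst sum_Pow_singletons) (use unit_sphere_eq_0[OF j] in \<open>auto simp: unit_sphere_def\<close>)
  finally show ?thesis by (simp add: cl_norm_def cmod_def)
qed

lemma paravec_eq_para:
  assumes "1 \<le> n" "x \<in> paravec n"
  obtains j z where "j \<in> unit_sphere n" "x = para (Re z) (Im z) j"
proof -
  define s where "s = sqrt (\<Sum>l\<in>{1..n}. (x {l})\<^sup>2)"
  have s2: "s\<^sup>2 = (\<Sum>l\<in>{1..n}. (x {l})\<^sup>2)" by (simp add: s_def sum_nonneg)
  define y where "y = (\<lambda>A. if A = {} then 0 else x A)"
  have x: "x = (\<lambda>A. cl_real (x {}) A + y A)" by (auto simp: cl_real_def y_def)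
  show thesis
  proof (cases "s = 0")
    case True
    \<comment> \<open>A real paravector lies on every slice, so any unit serves;
      \<open>1 \<le> n\<close> makes the first generator available.\<close>
    define j :: cliff where "j = (\<lambda>A. if A = {1} then 1 else 0)"
    have "j \<in> unit_sphere n"
      using \<open>1 \<le> n\<close> unfolding unit_sphere_def paravec_def clifford_def j_def
      by (auto simp: if_distrib[of "\<lambda>x. x\<^sup>2"] cong: if_cong)
    moreover have "\<forall>l\<in>{1..n}. x {l} = 0"
      using True s2 by (simp add: sum_nonneg_eq_0_iff)
    then have "x A = 0" if "A \<noteq> {}" for A
    proof (cases "A \<subseteq> {1..n} \<and> card A < 2")
      case True
      then have "card A = 1" using that finite_subset[of A "{1..n}"] by (cases "card A") auto
      then show ?thesis using True \<open>\<forall>l\<in>{1..n}. x {l} = 0\<close> by (auto simp: card_1_singleton_iff)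
    qed (use assms in \<open>auto simp: paravec_def clifford_def\<close>)
    then have "x = para (Re (complex_of_real (x {}))) (Im (complex_of_real (x {}))) j"
      by (auto simp: para_def cl_real_def)
    ultimately show ?thesis using that by blast
  next
    case False
    have "(\<lambda>A. y A / s) \<in> unit_sphere n"
      using False assms s2 unfolding unit_sphere_def paravec_def clifford_def y_def
      by (auto simp: power_divide simp flip: sum_divide_distrib)
    moreover have "x = para (Re (Complex (x {}) s)) (Im (Complex (x {}) s)) (\<lambda>A. y A / s)"
      using False by (subst x) (simp add: para_def)
    ultimately show ?thesis using that by blast
  qed
qed

section \<open>Slice power series\<close>

text \<open>The value \<open>-\<infinity>\<close> at \<open>0\<close> makes the equivalence hold at
  zeros of the function too.\<close>

lemma eln_le_iff: "0 \<le> t \<Longrightarrow> eln t \<le> ereal y \<longleftrightarrow> t \<le> exp y"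
  by (cases "t = 0") (auto simp: eln_def ln_le_cancel_iff[of t "exp y", simplified, symmetric])

locale slice_power_series =
  fixes n :: nat and f :: "cliff \<Rightarrow> cliff" and a :: "nat \<Rightarrow> cliff"
  assumes n: "1 \<le> n" and a: "\<And>l. a l \<in> clifford n"
    and series: "\<And>x A. x \<in> paravec n \<Longrightarrow>
      (\<lambda>N. \<Sum>l<N. cl_mult n (cl_pow n x l) (a l) A) \<longlonglongrightarrow> f x A"
begin

lemma series_para:
  assumes "j \<in> unit_sphere n"
  shows "(\<lambda>l. Re (z ^ l) * a l A + Im (z ^ l) * cl_mult n j (a l) A) sums f (para (Re z) (Im z) j) A"
  using series[OF para_paravec[OF assms], of "Re z" "Im z" A]
  by (simp add: sums_def cl_pow_para[OF assms] cl_mult_para[OF a])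

lemma unit_sphere_nonempty: obtains j where "j \<in> unit_sphere n"
proof -
  have "(\<lambda>_. 0) \<in> paravec n" by (simp add: paravec_def clifford_def)
  then show thesis using paravec_eq_para[OF n] that by metis
qed

text \<open>On the real axis the slice series is an ordinary power series in each coordinate;
  convergence at \<open>r + 1\<close> forces absolute convergence at \<open>r\<close>.\<close>

lemma summable_coeff:
  assumes "0 \<le> r" shows "summable (\<lambda>l. \<bar>a l A * r ^ l\<bar>)"
proof -
  obtain j where j: "j \<in> unit_sphere n" by (rule unit_sphere_nonempty)
  have "(\<lambda>l. a l A * x ^ l) sums f (para x 0 j) A" for x
    using series_para[OF j, of "complex_of_real x" A]
    by (simp add: mult.commute flip: of_real_power)
  then have "summable (\<lambda>l. a l A * (r + 1) ^ l)" by (rule sums_summable)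
  then show ?thesis
    using powser_insidea[of "\<lambda>l. a l A" "r + 1" r] assms by simp
qed

text \<open>Averaging over \<^term>\<open>z\<close> and \<^term>\<open>cnj z\<close> removes the slice direction and leaves the
  cosine series of the coefficients.\<close>

lemma coeff_bound:
  assumes "0 < r" "1 \<le> m" and M: "\<And>x. x \<in> paravec n \<Longrightarrow> cl_norm n x = r \<Longrightarrow> cl_norm n (f x) \<le> M"
  shows "cl_norm n (a m) * r ^ m \<le> 2 ^ n * (2 * M)"
proof -
  obtain j where j: "j \<in> unit_sphere n" by (rule unit_sphere_nonempty)
  have "\<bar>a m A\<bar> \<le> 2 * M / r ^ m" if A: "A \<subseteq> {1..n}" for A
  proof -
    define F where "F z = f (para (Re z) (Im z) j) A" for z
    define h where "h x = (F (rcis r x) + F (rcis r (- x))) / 2" for x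
    have F: "\<bar>F (rcis r x)\<bar> \<le> M" for x
    proof -
      have "\<bar>F (rcis r x)\<bar> \<le> cl_norm n (f (para (Re (rcis r x)) (Im (rcis r x)) j))"
        unfolding F_def using A by (rule abs_le_cl_norm)
      also have "\<dots> \<le> M"
        using \<open>0 < r\<close> by (intro M para_paravec[OF j]) (simp only: cl_norm_para[OF j] complex_mod_rcis)
      finally show ?thesis .
    qed
    have "(\<lambda>l. a l A * r ^ l * cos (real l * x)) sums h x" for x
    proof -
      have "(\<lambda>l. ((Re (rcis r x ^ l) * a l A + Im (rcis r x ^ l) * cl_mult n j (a l) A) +
          (Re (rcis r (- x) ^ l) * a l A + Im (rcis r (- x) ^ l) * cl_mult n j (a l) A)) / 2) sums h x"
        unfolding h_def F_def by (intro sums_divide sums_add series_para[OF j])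
      then show ?thesis by (simp add: DeMoivre2 mult_ac)
    qed
    moreover have "\<bar>h x\<bar> \<le> M" for x
      using F[of x] F[of "- x"] by (simp add: h_def)
    ultimately have "\<bar>a m A * r ^ m\<bar> \<le> 2 * M"
      using summable_coeff[of r A] assms by (intro cosine_series_coeff_bound[where h = h]) auto
    then show ?thesis using assms by (simp add: abs_mult field_simps)
  qed
  then have "cl_norm n (a m) \<le> 2 ^ n * (2 * M / r ^ m)" by (rule cl_norm_le)
  then show ?thesis using assms by (simp add: field_simps)
qed

text \<open>On a slice each coordinate of a term is bounded through the real and imaginary parts of
  \<open>z ^ l\<close>; left multiplication by \<open>j\<close> costs \<open>4 ^ n\<close>, and a
  geometric series remains.\<close>

lemma norm_le_geometric:
  assumes x: "x \<in> paravec n" and q: "0 < q" "q < 1"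
    and le: "\<And>l. cl_norm n (a l) * cl_norm n x ^ l \<le> E * q ^ l"
  shows "cl_norm n (f x) \<le> 2 ^ n * ((1 + 4 ^ n) * E / (1 - q))"
proof (rule cl_norm_le)
  fix A assume "A \<subseteq> {1..n}"
  obtain j z where j: "j \<in> unit_sphere n" and xz: "x = para (Re z) (Im z) j"
    using paravec_eq_para[OF n x] by blast
  have normx: "cl_norm n x = cmod z" by (simp only: xz cl_norm_para[OF j])
  \<comment> \<open>Viewing \<open>j\<close> as the slice image of the imaginary unit gives its norm
    from \<open>cl_norm_para\<close>.\<close>
  have "para (Re \<i>) (Im \<i>) j = j" by (auto simp: para_def cl_real_def)
  then have normj: "cl_norm n j = 1" using cl_norm_para[OF j, of \<i>] by simp
  let ?t = "\<lambda>l. Re (z ^ l) * a l A + Im (z ^ l) * cl_mult n j (a l) A"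
  have t: "norm (?t l) \<le> (1 + 4 ^ n) * E * q ^ l" for l
  proof -
    have "norm (?t l) \<le> \<bar>Re (z ^ l)\<bar> * \<bar>a l A\<bar> + \<bar>Im (z ^ l)\<bar> * \<bar>cl_mult n j (a l) A\<bar>"
      by (metis abs_mult abs_triangle_ineq real_norm_def)
    also have "\<dots> \<le> cmod (z ^ l) * cl_norm n (a l) + cmod (z ^ l) * (4 ^ n * cl_norm n (a l))"
      using cl_mult_bound[of n j "a l" A] \<open>A \<subseteq> {1..n}\<close> normj
      by (intro add_mono mult_mono abs_Re_le_cmod abs_Im_le_cmod abs_le_cl_norm) auto
    also have "\<dots> = (1 + 4 ^ n) * (cl_norm n (a l) * cl_norm n x ^ l)"
      by (simp add: normx norm_power algebra_simps)
    also have "\<dots> \<le> (1 + 4 ^ n) * (E * q ^ l)" by (intro mult_left_mono le) auto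
    finally show ?thesis by (simp add: mult.assoc)
  qed
  have "(\<lambda>l. (1 + 4 ^ n) * E * q ^ l) sums ((1 + 4 ^ n) * E * (1 / (1 - q)))"
    using q by (intro sums_mult geometric_sums) auto
  moreover have "?t sums f x A" unfolding xz by (rule series_para[OF j])
  ultimately show "\<bar>f x A\<bar> \<le> (1 + 4 ^ n) * E / (1 - q)"
    using norm_suminf_le[of ?t "\<lambda>l. (1 + 4 ^ n) * E * q ^ l"] t by (simp add: sums_iff)
qed

end

section \<open>The common exponential growth condition\<close>

definition exp_growth :: "nat \<Rightarrow> (real \<Rightarrow> real) \<Rightarrow> (cliff \<Rightarrow> cliff) \<Rightarrow> real \<Rightarrow> bool" where
  "exp_growth n \<rho>r f s \<longleftrightarrow> (\<exists>M>0. \<forall>x\<in>paravec n.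
     cl_norm n (f x) \<le> M * exp (s * cl_norm n x powr \<rho>r (cl_norm n x)))"

lemma A_class_iff: "f \<in> A_class n \<rho>r s \<longleftrightarrow> SM_L n f \<and> exp_growth n \<rho>r f s"
proof -
  have "u * exp (- s * v) \<le> M \<longleftrightarrow> u \<le> M * exp (s * v)" for u v M :: real
    by (simp add: exp_minus field_simps)
  moreover have "(\<exists>M>0. \<forall>x\<in>paravec n. cl_norm n (f x) \<le> M * exp (s * cl_norm n x powr \<rho>r (cl_norm n x)))
      \<longleftrightarrow> (\<exists>M. \<forall>x\<in>paravec n. cl_norm n (f x) \<le> M * exp (s * cl_norm n x powr \<rho>r (cl_norm n x)))"
  proof (intro iffI; elim exE conjE)
    fix M assume "\<forall>x\<in>paravec n. cl_norm n (f x) \<le> M * exp (s * cl_norm n x powr \<rho>r (cl_norm n x))"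
    then have "\<forall>x\<in>paravec n. cl_norm n (f x) \<le> max M 1 * exp (s * cl_norm n x powr \<rho>r (cl_norm n x))"
      by (meson exp_ge_zero max.cobounded1 mult_right_mono order_trans)
    then show "\<exists>M>0. \<forall>x\<in>paravec n. cl_norm n (f x) \<le> M * exp (s * cl_norm n x powr \<rho>r (cl_norm n x))"
      \<comment> \<open>Enlarging the constant makes it positive, so that its logarithm may be taken
        later.\<close>
      by (intro exI[of _ "max M 1"]) auto
  qed blast
  ultimately show ?thesis by (simp add: A_class_def exp_growth_def)
qed

lemma exp_growth_mono:
  assumes "exp_growth n \<rho>r f s" "s \<le> t" shows "exp_growth n \<rho>r f t"
proof -
  obtain M where M: "0 < M"
    "\<And>x. x \<in> paravec n \<Longrightarrow> cl_norm n (f x) \<le> M * exp (s * cl_norm n x powr \<rho>r (cl_norm n x))"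
    using assms(1) by (auto simp: exp_growth_def)
  have le: "M * exp (s * v) \<le> M * exp (t * v)" if "0 \<le> v" for v
    using M(1) mult_right_mono[OF assms(2) that] by simp
  have "cl_norm n (f x) \<le> M * exp (t * cl_norm n x powr \<rho>r (cl_norm n x))"
    if "x \<in> paravec n" for x
    using M(2)[OF that] le by (rule order_trans) simp
  with M(1) show ?thesis unfolding exp_growth_def by blast
qed

lemma A_class_plus0_iff:
  "f \<in> A_class_plus0 n \<rho>r \<sigma> \<longleftrightarrow> (\<forall>s>\<sigma>. f \<in> A_class n \<rho>r s)"
proof -
  have "(\<forall>\<epsilon>>0. f \<in> A_class n \<rho>r (\<sigma> + \<epsilon>)) \<longleftrightarrow> (\<forall>s>\<sigma>. f \<in> A_class n \<rho>r s)"
    by (metis add.commute diff_add_cancel diff_gt_0_iff_gt less_add_same_cancel1)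
  then show ?thesis by (auto simp: A_class_plus0_def)
qed

text \<open>An infimum below \<open>s\<close> yields a member \<open>\<beta> < s\<close>, and growth
  is monotone in the type. Conversely every \<open>s > \<sigma>\<close> is a positive member of the
  set.\<close>

lemma Inf_A_class_le_iff:
  assumes "SM_L n f" "0 \<le> \<sigma>"
  shows "Inf (ereal ` {\<beta>. 0 < \<beta> \<and> f \<in> A_class n \<rho>r \<beta>}) \<le> ereal \<sigma>
    \<longleftrightarrow> (\<forall>s>\<sigma>. exp_growth n \<rho>r f s)"
proof
  assume L: "Inf (ereal ` {\<beta>. 0 < \<beta> \<and> f \<in> A_class n \<rho>r \<beta>}) \<le> ereal \<sigma>"
  show "\<forall>s>\<sigma>. exp_growth n \<rho>r f s"
  proof (intro allI impI)
    fix s assume "\<sigma> < s"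
    then have "Inf (ereal ` {\<beta>. 0 < \<beta> \<and> f \<in> A_class n \<rho>r \<beta>}) < ereal s"
      using L by (simp add: order_le_less_trans)
    then obtain \<beta> where "f \<in> A_class n \<rho>r \<beta>" "\<beta> < s" by (auto simp: Inf_less_iff)
    then show "exp_growth n \<rho>r f s"
      by (auto simp: A_class_iff intro: exp_growth_mono)
  qed
next
  assume R: "\<forall>s>\<sigma>. exp_growth n \<rho>r f s"
  show "Inf (ereal ` {\<beta>. 0 < \<beta> \<and> f \<in> A_class n \<rho>r \<beta>}) \<le> ereal \<sigma>"
  proof (rule dense_ge)
    fix y assume "ereal \<sigma> < y"
    then obtain s where s: "ereal \<sigma> < ereal s" "ereal s < y" using ereal_dense2 by blast
    then have "Inf (ereal ` {\<beta>. 0 < \<beta> \<and> f \<in> A_class n \<rho>r \<beta>}) \<le> ereal s"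
      using R assms by (intro Inf_lower) (auto simp: A_class_iff)
    then show "Inf (ereal ` {\<beta>. 0 < \<beta> \<and> f \<in> A_class n \<rho>r \<beta>}) \<le> y"
      using s(2) by simp
  qed
qed

section \<open>Limsup conditions equivalent to exponential growth\<close>

context normalized_proximate_order
begin

lemma Limsup_eln_le_iff:
  assumes "0 \<le> \<sigma>"
  shows "Limsup at_top (\<lambda>r. (SUP x\<in>{x\<in>paravec n. cl_norm n x \<le> r}. eln (cl_norm n (f x))) / ereal (V r))
      \<le> ereal \<sigma> \<longleftrightarrow> (\<forall>s>\<sigma>. exp_growth n \<rho>r f s)"
    (is "Limsup at_top (\<lambda>r. ?S r / _) \<le> _ \<longleftrightarrow> _")
proof
  assume L: "Limsup at_top (\<lambda>r. ?S r / ereal (V r)) \<le> ereal \<sigma>"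
  show "\<forall>s>\<sigma>. exp_growth n \<rho>r f s"
  proof (intro allI impI)
    fix s assume s: "\<sigma> < s"
    then have "\<forall>\<^sub>F r in at_top. ?S r / ereal (V r) < ereal s"
      using L[unfolded Limsup_le_iff, rule_format, of "ereal s"] by simp
    then obtain R0 where R0: "\<And>r. R0 \<le> r \<Longrightarrow> ?S r / ereal (V r) < ereal s"
      by (auto simp: eventually_at_top_linorder)
    define R where "R = max R0 1"
    have "cl_norm n (f x) \<le> exp (s * V R) * exp (s * V (cl_norm n x))" if x: "x \<in> paravec n" for x
    proof -
      \<comment> \<open>The limsup controls only large radii; a point of norm below \<open>R\<close>
        is treated in the ball of radius \<open>R\<close>, at the price of the constant
        \<open>exp (s * V R)\<close>.\<close>
      define r where "r = max R (cl_norm n x)"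
      have r: "0 < r" "R0 \<le> r" by (auto simp: r_def R_def)
      have "eln (cl_norm n (f x)) \<le> ?S r"
        using x by (intro SUP_upper) (auto simp: r_def)
      also have "?S r \<le> ereal (V r) * ereal s"
        using R0[OF r(2)] r by (intro ereal_divide_le_pos[THEN iffD1] less_imp_le) simp_all
      finally have "cl_norm n (f x) \<le> exp (s * V r)"
        by (simp add: eln_le_iff cl_norm_nonneg mult.commute)
      also have "V r \<le> V R + V (cl_norm n x)" by (auto simp: r_def max_def)
      then have "exp (s * V r) \<le> exp (s * (V R + V (cl_norm n x)))"
        using s assms by simp
      finally show ?thesis by (simp add: ring_distribs exp_add)
    qed
    then show "exp_growth n \<rho>r f s" unfolding exp_growth_def by (intro exI[of _ "exp (s * V R)"]) simp
  qed
next
  assume growth: "\<forall>s>\<sigma>. exp_growth n \<rho>r f s"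
  show "Limsup at_top (\<lambda>r. ?S r / ereal (V r)) \<le> ereal \<sigma>"
    unfolding Limsup_le_iff
  proof (intro allI impI)
    fix y assume "ereal \<sigma> < y"
    then obtain t where "ereal \<sigma> < ereal t" and t: "ereal t < y" using ereal_dense2 by blast
    then have "\<sigma> < t" by simp
    obtain s where s: "\<sigma> < s" "s < t" using dense[OF \<open>\<sigma> < t\<close>] by blast
    obtain M where M: "0 < M" "\<And>x. x \<in> paravec n \<Longrightarrow> cl_norm n (f x) \<le> M * exp (s * V (cl_norm n x))"
      using growth s(1) by (auto simp: exp_growth_def)
    \<comment> \<open>The gap between \<open>s\<close> and \<open>t\<close> absorbs the
      multiplicative constant \<open>M\<close> once \<open>V r\<close> is large.\<close>
    have "\<forall>\<^sub>F r in at_top. ln M / (t - s) \<le> V r" using V_at_top by (simp add: filterlim_at_top)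
    with eventually_gt_at_top[of 0] show "\<forall>\<^sub>F r in at_top. ?S r / ereal (V r) < y"
    proof eventually_elim
      case (elim r)
      have "?S r \<le> ereal (V r) * ereal t"
      proof (rule SUP_least)
        fix x assume x: "x \<in> {x \<in> paravec n. cl_norm n x \<le> r}"
        have "s * V (cl_norm n x) \<le> s * V r"
          using x s assms cl_norm_nonneg by (intro mult_left_mono V_mono) auto
        moreover have "ln M \<le> (t - s) * V r" using elim s by (simp add: field_simps)
        ultimately have "ln M + s * V (cl_norm n x) \<le> t * V r" by (simp add: left_diff_distrib)
        then have "exp (ln M + s * V (cl_norm n x)) \<le> exp (t * V r)" by simp
        then have "M * exp (s * V (cl_norm n x)) \<le> exp (t * V r)" using M(1) by (simp add: exp_add)
        then have "cl_norm n (f x) \<le> exp (t * V r)" using M(2)[of x] x by simp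
        then show "eln (cl_norm n (f x)) \<le> ereal (V r) * ereal t"
          by (simp add: eln_le_iff cl_norm_nonneg mult.commute)
      qed
      then have "?S r / ereal (V r) \<le> ereal t"
        using elim by (intro ereal_divide_le_pos[THEN iffD2]) simp_all
      then show ?case using t by simp
    qed
  qed
qed

lemma Limsup_coeff_le_iff:
  assumes "slice_power_series n f a" "0 \<le> \<sigma>"
  shows "limsup (\<lambda>l. ereal (root l (cl_norm n (a l)) * \<phi> (real l))) \<le> ereal (K \<sigma>)
    \<longleftrightarrow> (\<forall>s>\<sigma>. exp_growth n \<rho>r f s)"
    (is "?L \<le> _ \<longleftrightarrow> _")
proof
  interpret slice_power_series n f a by fact
  assume L: "?L \<le> ereal (K \<sigma>)"
  show "\<forall>s>\<sigma>. exp_growth n \<rho>r f s"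
  proof (intro allI impI)
    fix s assume "\<sigma> < s"
    then obtain M q where Mq: "0 \<le> M" "0 < q" "q < 1"
      "\<And>l r. 0 \<le> r \<Longrightarrow> cl_norm n (a l) * r ^ l \<le> M * q ^ l * exp (s * V r)"
      using growth_of_Limsup_root_le[OF cl_norm_nonneg assms(2) _ L] by blast
    define C where "C = 2 ^ n * ((1 + 4 ^ n) * M / (1 - q))"
    \<comment> \<open>The summand \<open>1\<close> secures the strictly positive constant that
      \<open>exp_growth\<close> demands, since \<open>C\<close> may be \<open>0\<close>.\<close>
    have "cl_norm n (f x) \<le> (C + 1) * exp (s * V (cl_norm n x))" if "x \<in> paravec n" for x
    proof -
      have "cl_norm n (f x) \<le> 2 ^ n * ((1 + 4 ^ n) * (M * exp (s * V (cl_norm n x))) / (1 - q))"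
        using that Mq(2,3) Mq(4)[OF cl_norm_nonneg] by (intro norm_le_geometric) (simp_all add: mult_ac)
      also have "\<dots> = C * exp (s * V (cl_norm n x))" by (simp add: C_def)
      also have "\<dots> \<le> (C + 1) * exp (s * V (cl_norm n x))" by (intro mult_right_mono) auto
      finally show ?thesis .
    qed
    moreover have "0 < C + 1" using Mq by (simp add: C_def add_nonneg_pos)
    ultimately show "exp_growth n \<rho>r f s" unfolding exp_growth_def by blast
  qed
next
  interpret slice_power_series n f a by fact
  assume growth: "\<forall>s>\<sigma>. exp_growth n \<rho>r f s"
  show "?L \<le> ereal (K \<sigma>)"
  proof (rule dense_ge)
    fix y assume "ereal (K \<sigma>) < y"
    \<comment> \<open>The coefficient bound is first proved at \<open>s > \<sigma>\<close>; letting
      \<open>y\<close> decrease to \<open>K \<sigma>\<close> then removes the excess.\<close>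
    then obtain s where s: "\<sigma> < s" "ereal (K s) < y" using K_interpolate assms(2) by blast
    obtain M where M: "0 < M" "\<And>x. x \<in> paravec n \<Longrightarrow> cl_norm n (f x) \<le> M * exp (s * V (cl_norm n x))"
      using growth s(1) by (auto simp: exp_growth_def)
    have "?L \<le> ereal (K s)"
    proof (rule Limsup_root_le_of_growth[OF cl_norm_nonneg])
      fix l :: nat and r :: real assume "1 \<le> l" "0 < r"
      then have "cl_norm n (a l) * r ^ l \<le> 2 ^ n * (2 * (M * exp (s * V r)))"
        using M(2) by (intro coeff_bound) auto
      then show "cl_norm n (a l) * r ^ l \<le> (2 ^ n * 2 * M) * exp (s * V r)"
        by (simp add: mult.assoc)
    qed (use s M assms in auto)
    then show "?L \<le> y" using s(2) by simp
  qed
qed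

end

theorem theorem3p7:
  fixes n :: nat and \<rho>r :: "real \<Rightarrow> real" and \<rho> \<sigma> :: real
    and f :: "cliff \<Rightarrow> cliff" and a :: "nat \<Rightarrow> cliff"
  assumes "1 \<le> n"
    and "proximate_order \<rho>r \<rho>" and "normalized_po \<rho>r"
    and "0 \<le> \<sigma>"
    and "SM_L n f"
    and "\<forall>l. a l \<in> clifford n"
    and "\<forall>x\<in>paravec n. \<forall>A.
           (\<lambda>N. \<Sum>l<N. cl_mult n (cl_pow n x l) (a l) A) \<longlonglongrightarrow> f x A"
  shows "(f \<in> A_class_plus0 n \<rho>r \<sigma>
          \<longleftrightarrow> Limsup at_top (\<lambda>r. (SUP x\<in>{x\<in>paravec n. cl_norm n x \<le> r}. eln (cl_norm n (f x)))
                                  / ereal (r powr \<rho>r r)) \<le> ereal \<sigma>)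
       \<and> (f \<in> A_class_plus0 n \<rho>r \<sigma>
          \<longleftrightarrow> limsup (\<lambda>l. ereal (root l (cl_norm n (a l)) * po_inv \<rho>r (real l)))
                \<le> ereal ((exp 1 * \<rho> * \<sigma>) powr (1 / \<rho>)))
       \<and> (f \<in> A_class_plus0 n \<rho>r \<sigma>
          \<longleftrightarrow> Inf (ereal ` {\<beta>. 0 < \<beta> \<and> f \<in> A_class n \<rho>r \<beta>}) \<le> ereal \<sigma>)"
proof -
  interpret normalized_proximate_order \<rho>r \<rho>
    using assms by unfold_locales
  have series: "slice_power_series n f a"
    using assms by unfold_locales auto
  have "f \<in> A_class_plus0 n \<rho>r \<sigma> \<longleftrightarrow> (\<forall>s>\<sigma>. exp_growth n \<rho>r f s)"
    using \<open>SM_L n f\<close> by (simp add: A_class_plus0_iff A_class_iff)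
  then show ?thesis
    using Limsup_eln_le_iff[OF \<open>0 \<le> \<sigma>\<close>, of n f] Inf_A_class_le_iff[OF \<open>SM_L n f\<close> \<open>0 \<le> \<sigma>\<close>, of \<rho>r]
      Limsup_coeff_le_iff[OF series \<open>0 \<le> \<sigma>\<close>] unfolding K_def
    by simp
qed

end
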